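(* Consider any Relative-Threshold$(f(n))$ process with $f(n)\ge\log n$. Then, for all sufficiently large $n$ and for $m:=\frac1{24}\cdot\frac{n\cdot(f(n))^2}{\log n}$ (rounded down to an integer), $$\Pr\Big[\mathrm{Gap}(m)\ge\frac{f(n)}{50}\Big]\ge1-n^{-1/4}.$$
   Context: Relative-Threshold$(f(n))$ process on $n$ bins, with offset function $f(n)\ge0$: start with the empty load vector $x^0=(0,\dots,0)$. In each round $t\ge0$ sample two bins $i_1,i_2\in[n]$ independently and uniformly at random; allocate one ball to $i_1$ if $x_{i_1}^t<\frac tn+f(n)$, and one ball to $i_2$ if $x_{i_1}^t\ge\frac tn+f(n)$. Here $x^t$ is the load vector after $t$ rounds and $\mathrm{Gap}(t)=\max_{i\in[n]}x_i^t-\frac tn$. *)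

theory Defs
  imports "HOL-Probability.Probability"
begin

text \<open>Bins are \<open>{..<n}\<close>; a load vector \<open>x :: nat \<Rightarrow> nat\<close> is only meaningful there (and stays \<open>0\<close>
  elsewhere). Since \<open>pmf_of_set {}\<close> is unspecified, the definitions are meant for \<open>n > 0\<close>.\<close>

definition rel_threshold_round ::
    "nat \<Rightarrow> (nat \<Rightarrow> real) \<Rightarrow> nat \<Rightarrow> (nat \<Rightarrow> nat) \<Rightarrow> (nat \<Rightarrow> nat) pmf" where
  "rel_threshold_round n f t x =
     bind_pmf (pmf_of_set {..<n}) (\<lambda>i1.
     bind_pmf (pmf_of_set {..<n}) (\<lambda>i2.
       return_pmf
         (if real (x i1) < real t / real n + f n
          then x(i1 := x i1 + 1)
          else x(i2 := x i2 + 1))))"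

text \<open>The distribution of the load vector \<open>x\<^sup>t\<close> after rounds \<open>0, \<dots>, t - 1\<close>.\<close>

primrec rel_threshold ::
    "nat \<Rightarrow> (nat \<Rightarrow> real) \<Rightarrow> nat \<Rightarrow> (nat \<Rightarrow> nat) pmf" where
  "rel_threshold n f 0 = return_pmf (\<lambda>_. 0)"
| "rel_threshold n f (Suc t) = bind_pmf (rel_threshold n f t) (rel_threshold_round n f t)"

definition gap :: "nat \<Rightarrow> nat \<Rightarrow> (nat \<Rightarrow> nat) \<Rightarrow> real" where
  "gap n t x = real (Max (x ` {..<n})) - real t / real n"

end

(* Below the threshold the process is One-Choice: each ball goes to a uniform bin. With
   a = f(n) / log n, a union bound over the bins and a maximal inequality for exp(l x_i), l = 2 / a,
   show that One-Choice stays below the threshold up to time m except with probability n^(-3/4).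
   For l = 1 / a, a second moment bound shows that W = sum_i exp(l x_i) is at least E[W] / 2 with
   probability 1 - 4 n^(-5/6), and W <= n exp(l max_i x_i) turns this into a lower bound of about
   f(n) / 48 for the gap. *)

theory Submission
  imports Defs "HOL-Real_Asymp.Real_Asymp"
begin

section \<open>One-Choice and its exponential moments\<close>

text \<open>The start vector is a parameter and the recursion peels off the first ball, so that the
  law of the balls still to come can be read off at any intermediate state \<open>x\<close>; this is
  what \<open>g\<close> needs in the comparison below.\<close>

primrec one_choice :: "nat \<Rightarrow> nat \<Rightarrow> (nat \<Rightarrow> nat) \<Rightarrow> (nat \<Rightarrow> nat) pmf" where
  "one_choice n 0 x = return_pmf x"
| "one_choice n (Suc k) x =
     bind_pmf (pmf_of_set {..<n}) (\<lambda>i. one_choice n k (x(i := x i + 1)))"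

lemma set_pmf_of_bins [simp]: "n > 0 \<Longrightarrow> set_pmf (pmf_of_set {..<n}) = {..<n::nat}"
  by (rule set_pmf_of_set) auto

lemma finite_set_one_choice [simp]: "n > 0 \<Longrightarrow> finite (set_pmf (one_choice n k x))"
  by (induction k arbitrary: x) auto

lemma finite_set_rel_threshold_round [simp]:
  "n > 0 \<Longrightarrow> finite (set_pmf (rel_threshold_round n f t x))"
  by (auto simp: rel_threshold_round_def)

lemma finite_set_rel_threshold [simp]: "n > 0 \<Longrightarrow> finite (set_pmf (rel_threshold n f t))"
  by (induction t) auto

lemma expectation_one_choice_Suc:
  fixes h :: "(nat \<Rightarrow> nat) \<Rightarrow> real"
  assumes "n > 0"
  shows "measure_pmf.expectation (one_choice n (Suc k) x) h =
    (\<Sum>i<n. measure_pmf.expectation (one_choice n k (x(i := x i + 1))) h) / real n"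
  using assms
  by (simp add: pmf_expectation_bind_pmf_of_set sum_distrib_left[symmetric] divide_inverse
      mult.commute lessThan_empty_iff)

text \<open>Averaging over one ball multiplies \<open>G\<close> by a constant independent of the
  state, so the rounds compound to a power. Products of exponentials of loads are of this type,
  which yields every moment of \<open>W\<close> needed later.\<close>

lemma expectation_one_choice_multiplicative:
  fixes G :: "(nat \<Rightarrow> nat) \<Rightarrow> real"
  assumes "n > 0" and G: "\<And>x i. i < n \<Longrightarrow> G (x(i := x i + 1)) = c i * G x"
  shows "measure_pmf.expectation (one_choice n k x) G = ((\<Sum>i<n. c i) / real n) ^ k * G x"
proof (induction k arbitrary: x)
  case (Suc k)
  show ?case
    unfolding expectation_one_choice_Suc[OF \<open>n > 0\<close>] Suc.IH
    using G by (simp add: sum_distrib_left[symmetric] sum_distrib_right[symmetric])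
qed simp

section \<open>Comparison of the threshold process with One-Choice\<close>

lemma rel_threshold_round_below:
  assumes "n > 0" "\<And>i. i < n \<Longrightarrow> real (x i) < real t / real n + f n"
  shows "rel_threshold_round n f t x =
    bind_pmf (pmf_of_set {..<n}) (\<lambda>i. return_pmf (x(i := x i + 1)))"
  unfolding rel_threshold_round_def
  by (rule bind_pmf_cong) (use assms in \<open>auto simp: bind_pmf_const\<close>)

text \<open>\<open>V\<close> is a submartingale along the process. The one-step inequality is asked
  of every vector, reachable or not, so nothing has to be known about the law at time
  \<open>t\<close>.\<close>

lemma expectation_rel_threshold_mono:
  fixes V :: "nat \<Rightarrow> (nat \<Rightarrow> nat) \<Rightarrow> real"
  assumes "n > 0"
    and step: "\<And>t x. t < m \<Longrightarrow> V t x \<le> measure_pmf.expectation (rel_threshold_round n f t x) (V (Suc t))"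
  shows "V 0 (\<lambda>_. 0) \<le> measure_pmf.expectation (rel_threshold n f m) (V m)"
proof -
  have "V 0 (\<lambda>_. 0) \<le> measure_pmf.expectation (rel_threshold n f t) (V t)" if "t \<le> m" for t
    using that
  proof (induction t)
    case (Suc t)
    let ?S = "set_pmf (rel_threshold n f t)"
    have "V 0 (\<lambda>_. 0) \<le> measure_pmf.expectation (rel_threshold n f t) (V t)"
      using Suc by simp
    also have "\<dots> = (\<Sum>x\<in>?S. pmf (rel_threshold n f t) x * V t x)"
      using assms(1) by (subst integral_measure_pmf[of ?S]) auto
    also have "\<dots> \<le> (\<Sum>x\<in>?S. pmf (rel_threshold n f t) x *
        measure_pmf.expectation (rel_threshold_round n f t x) (V (Suc t)))"
      using Suc.prems by (intro sum_mono mult_left_mono step) auto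
    also have "\<dots> = measure_pmf.expectation (rel_threshold n f (Suc t)) (V (Suc t))"
      using assms(1) by (simp add: pmf_expectation_bind[of ?S])
    finally show ?case .
  qed simp
  then show ?thesis by simp
qed

text \<open>The last term bounds the probability that One-Choice ever reaches the threshold (Ville's
  inequality for the exponential supermartingale \<open>Z\<close>). Truncating at \<open>0\<close> makes a coupling
  unnecessary: once some load is at the threshold, \<open>Z \<ge> 1\<close> and the bound is void.\<close>

lemma prob_rel_threshold_ge_one_choice:
  fixes l :: real
  assumes n: "n > 0" and l: "l \<ge> 0"
  shows "measure_pmf.prob (rel_threshold n f m) A \<ge>
    measure_pmf.prob (one_choice n m (\<lambda>_. 0)) A
      - real n * exp ((exp l - 1 - l) * (real m / real n) - l * f n)"
proof -
  \<comment> \<open>A One-Choice ball multiplies the mean of exp(l x_j) by 1 + (l + \<kappa>)/n. The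
    part l/n is matched by the growth of the threshold; the excess \<kappa>/n is prepaid in
    \<open>Z\<close> through the remaining time \<open>m - t\<close>.\<close>
  define \<kappa> where "\<kappa> = exp l - 1 - l"
  have \<kappa>: "\<kappa> \<ge> 0" unfolding \<kappa>_def using exp_ge_add_one_self[of l] by linarith
  define Z where "Z t x =
    (\<Sum>i<n. exp (l * (real (x i) - real t / n - f n) + \<kappa> * (real (m - t) / n)))"
    for t and x :: "nat \<Rightarrow> nat"
  \<comment> \<open>The chance of ending in \<open>A\<close> if the remaining balls were all placed
    by One-Choice.\<close>
  define g where "g t x = measure_pmf.prob (one_choice n (m - t) x) A" for t x
  define V where "V t x = max 0 (g t x - Z t x)" for t x
  have Z_step: "(\<Sum>i<n. Z (Suc t) (x(i := x i + 1))) / n \<le> Z t x" if "t < m" for t x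
  proof -
    let ?z = "\<lambda>j. exp (l * (real (x j) - real t / n - f n) + \<kappa> * (real (m - t) / n))"
    have *: "exp (l * (real ((x(i := x i + 1)) j) - real (Suc t) / n - f n)
        + \<kappa> * (real (m - Suc t) / n)) =
        ?z j * exp (- (l + \<kappa>) / n) * (1 + (if i = j then exp l - 1 else 0))" for i j
    proof (cases "i = j")
      case True
      have "l * (real ((x(i := x i + 1)) j) - real (Suc t) / n - f n)
        + \<kappa> * (real (m - Suc t) / n) = l * (real (x j) - real t / n - f n)
        + \<kappa> * (real (m - t) / n) + (- (l + \<kappa>) / n) + l"
        using True that n by (simp add: field_simps of_nat_diff)
      then show ?thesis using True by (simp only: exp_add) simp
    next
      case False
      have "l * (real ((x(i := x i + 1)) j) - real (Suc t) / n - f n)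
        + \<kappa> * (real (m - Suc t) / n) = l * (real (x j) - real t / n - f n)
        + \<kappa> * (real (m - t) / n) + (- (l + \<kappa>) / n)"
        using False that n by (simp add: field_simps of_nat_diff)
      then show ?thesis using False by (simp only: exp_add) simp
    qed
    have "(\<Sum>i<n. Z (Suc t) (x(i := x i + 1))) =
        (\<Sum>j<n. \<Sum>i<n. ?z j * exp (- (l + \<kappa>) / n) * (1 + (if i = j then exp l - 1 else 0)))"
      unfolding Z_def * by (rule sum.swap)
    also have "\<dots> = (\<Sum>j<n. ?z j * exp (- (l + \<kappa>) / n) * (real n + (exp l - 1)))"
      by (intro sum.cong refl) (simp add: sum_distrib_left[symmetric] sum.distrib)
    also have "\<dots> = Z t x * exp (- (l + \<kappa>) / n) * (real n + (exp l - 1))"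
      by (simp add: Z_def sum_distrib_right)
    finally have "(\<Sum>i<n. Z (Suc t) (x(i := x i + 1))) / n =
        Z t x * (exp (- (l + \<kappa>) / n) * (1 + (l + \<kappa>) / n))"
      using n by (simp add: \<kappa>_def field_simps)
    also have "\<dots> \<le> Z t x * (exp (- (l + \<kappa>) / n) * exp ((l + \<kappa>) / n))"
      by (intro mult_left_mono exp_ge_add_one_self) (auto simp: Z_def intro!: sum_nonneg)
    also have "\<dots> = Z t x" by (simp add: exp_add[symmetric] add_divide_distrib[symmetric])
    finally show ?thesis .
  qed
  have "V 0 (\<lambda>_. 0) \<le> measure_pmf.expectation (rel_threshold n f m) (V m)"
  proof (rule expectation_rel_threshold_mono[OF n])
    fix t x assume t: "t < m"
    show "V t x \<le> measure_pmf.expectation (rel_threshold_round n f t x) (V (Suc t))"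
    proof (cases "\<forall>i<n. real (x i) < real t / n + f n")
      case True
      \<comment> \<open>First-step analysis: \<open>g\<close> is a martingale under One-Choice
        moves, which are the actual moves in this case.\<close>
      have g_step: "g t x = (\<Sum>i<n. g (Suc t) (x(i := x i + 1))) / n"
      proof -
        have "m - t = Suc (m - Suc t)" using t by simp
        then show ?thesis
          using expectation_one_choice_Suc[OF n, of "m - Suc t" x "indicator A"]
          by (simp add: g_def)
      qed
      have "g t x - Z t x \<le> (\<Sum>i<n. g (Suc t) (x(i := x i + 1)) - Z (Suc t) (x(i := x i + 1))) / n"
        using Z_step[OF t, of x] by (simp add: g_step sum_subtractf diff_divide_distrib)
      also have "\<dots> \<le> (\<Sum>i<n. V (Suc t) (x(i := x i + 1))) / n"
        by (intro divide_right_mono sum_mono) (auto simp: V_def)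
      finally have "V t x \<le> (\<Sum>i<n. V (Suc t) (x(i := x i + 1))) / n"
        unfolding V_def[of t] by (auto simp: V_def intro!: divide_nonneg_nonneg sum_nonneg)
      also have "\<dots> = measure_pmf.expectation (rel_threshold_round n f t x) (V (Suc t))"
        using n True
        by (subst rel_threshold_round_below) (auto simp: pmf_expectation_bind_pmf_of_set
            sum_distrib_left[symmetric] divide_inverse mult.commute lessThan_empty_iff)
      finally show ?thesis .
    next
      case False
      then obtain i where i: "i < n" "real (x i) \<ge> real t / n + f n" by force
      \<comment> \<open>The bin at the threshold alone contributes a term with nonnegative exponent,
        while \<open>g\<close> is at most 1. Hence \<open>V\<close> vanishes here and the
        non-uniform round need not be analysed.\<close>
      have "1 \<le> exp (l * (real (x i) - real t / n - f n) + \<kappa> * (real (m - t) / n))"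
        using i l \<kappa> by (auto intro!: add_nonneg_nonneg mult_nonneg_nonneg)
      also have "\<dots> \<le> Z t x"
        unfolding Z_def using i by (intro member_le_sum) auto
      finally have "V t x = 0"
        unfolding V_def g_def using measure_pmf.prob_le_1[of "one_choice n (m - t) x" A] by linarith
      then show ?thesis by (auto simp: V_def intro!: Bochner_Integration.integral_nonneg)
    qed
  qed
  also have "\<dots> \<le> measure_pmf.expectation (rel_threshold n f m) (indicator A)"
  proof (intro integral_mono integrable_measure_pmf_finite)
    fix x
    \<comment> \<open>With no rounds left, \<open>g m\<close> is the indicator of \<open>A\<close>,
      and subtracting \<open>Z\<close> only lowers it.\<close>
    have "Z m x \<ge> 0" unfolding Z_def by (intro sum_nonneg) auto
    then show "V m x \<le> indicator A x"
      by (auto simp: V_def g_def indicator_def)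
  qed (use n in auto)
  finally have "V 0 (\<lambda>_. 0) \<le> measure_pmf.prob (rel_threshold n f m) A" by simp
  moreover have "Z 0 (\<lambda>_. 0) = real n * exp (\<kappa> * (real m / real n) - l * f n)"
    by (simp add: Z_def algebra_simps)
  ultimately show ?thesis by (auto simp: V_def g_def \<kappa>_def)
qed

section \<open>Exponential sums and the gap under One-Choice\<close>

text \<open>Second moment method for \<open>W = \<Sum>\<^sub>i exp (l y\<^sub>i)\<close>; different bins are negatively correlated because
  \<open>1 + 2q \<le> (1 + q)\<^sup>2\<close>.\<close>

lemma prob_one_choice_exp_sum_small:
  fixes l :: real
  assumes n: "n > 0" and l: "l \<ge> 0"
  defines "q \<equiv> (exp l - 1) / real n"
  shows "measure_pmf.prob (one_choice n m (\<lambda>_. 0))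
      {y. (\<Sum>i<n. exp (l * real (y i))) \<le> real n * (1 + q) ^ m / 2}
    \<le> 4 / real n * exp (real m / real n * (exp l - 1)\<^sup>2)"
proof -
  define p where "p = one_choice n m (\<lambda>_. 0)"
  define W where "W y = (\<Sum>i<n. exp (l * real (y i)))" for y :: "nat \<Rightarrow> nat"
  define a where "a = (1 + q) ^ m"
  define b where "b = (1 + (exp (2 * l) - 1) / n) ^ m"
  have q0: "q \<ge> 0" using l by (simp add: q_def)
  have a0: "a > 0" using q0 by (simp add: a_def)
  have int: "integrable p h" for h :: "(nat \<Rightarrow> nat) \<Rightarrow> real"
    using n by (intro integrable_measure_pmf_finite) (simp add: p_def)
  have E1: "measure_pmf.expectation p (\<lambda>y. exp (l * real (y i))) = a" if "i < n" for i
  proof -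
    have "measure_pmf.expectation p (\<lambda>y. exp (l * real (y i))) =
        ((\<Sum>j<n. 1 + (if j = i then exp l - 1 else 0)) / real n) ^ m * exp (l * 0)"
      unfolding p_def
      by (subst expectation_one_choice_multiplicative[OF n,
            where c = "\<lambda>j. 1 + (if j = i then exp l - 1 else 0)"])
        (auto simp: algebra_simps exp_add)
    also have "\<dots> = a"
      using that n by (simp add: sum.distrib a_def q_def add_divide_distrib)
    finally show ?thesis .
  qed
  have E2: "measure_pmf.expectation p (\<lambda>y. exp (l * real (y i)) * exp (l * real (y i))) = b"
    if "i < n" for i
  proof -
    have "measure_pmf.expectation p (\<lambda>y. exp (l * real (y i)) * exp (l * real (y i))) =
        ((\<Sum>j<n. 1 + (if j = i then exp (2 * l) - 1 else 0)) / real n) ^ m * 1"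
      unfolding p_def
      by (subst expectation_one_choice_multiplicative[OF n,
            where c = "\<lambda>j. 1 + (if j = i then exp (2 * l) - 1 else 0)"])
        (auto simp: algebra_simps exp_add[symmetric])
    also have "\<dots> = b"
      using that n by (simp add: sum.distrib b_def add_divide_distrib)
    finally show ?thesis .
  qed
  have E3: "measure_pmf.expectation p (\<lambda>y. exp (l * real (y i)) * exp (l * real (y j))) \<le> a\<^sup>2"
    if "i < n" "j < n" "i \<noteq> j" for i j
  proof -
    have "measure_pmf.expectation p (\<lambda>y. exp (l * real (y i)) * exp (l * real (y j))) =
        ((\<Sum>k<n. 1 + (if k = i then exp l - 1 else 0) + (if k = j then exp l - 1 else 0))
          / real n) ^ m * 1"
      unfolding p_def
      by (subst expectation_one_choice_multiplicative[OF n,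
            where c = "\<lambda>k. 1 + (if k = i then exp l - 1 else 0) + (if k = j then exp l - 1 else 0)"])
        (use that in \<open>auto simp: algebra_simps exp_add\<close>)
    also have "\<dots> = (1 + 2 * q) ^ m"
      using that n by (simp add: sum.distrib q_def field_simps)
    also have "\<dots> \<le> ((1 + q)\<^sup>2) ^ m"
      using q0 by (intro power_mono) (auto simp: power2_eq_square algebra_simps)
    also have "\<dots> = a\<^sup>2" by (simp add: a_def power_mult[symmetric] mult.commute)
    finally show ?thesis .
  qed
  have EW: "measure_pmf.expectation p W = n * a"
    unfolding W_def by (subst Bochner_Integration.integral_sum) (auto simp: int E1)
  have "measure_pmf.expectation p (\<lambda>y. (W y)\<^sup>2) =
      (\<Sum>i<n. \<Sum>j<n. measure_pmf.expectation p (\<lambda>y. exp (l * real (y i)) * exp (l * real (y j))))"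
    unfolding W_def power2_eq_square sum_product
    by (simp add: Bochner_Integration.integral_sum int)
  \<comment> \<open>The diagonal is overestimated by \<open>a\<^sup>2 + b\<close>, which makes the
    sum exactly the squared mean plus n b; the variance is then at most n b.\<close>
  also have "\<dots> \<le> (\<Sum>i<n. \<Sum>j<n. a\<^sup>2 + (if j = i then b else 0))"
    by (intro sum_mono) (auto simp: E2 E3)
  also have "\<dots> = (real n * a)\<^sup>2 + n * b"
    by (simp add: sum.distrib power2_eq_square algebra_simps)
  finally have EW2: "measure_pmf.expectation p (\<lambda>y. (W y)\<^sup>2) \<le> (real n * a)\<^sup>2 + n * b" .
  have var: "measure_pmf.expectation p (\<lambda>y. (W y - real n * a)\<^sup>2) \<le> n * b"
  proof -
    have "measure_pmf.variance p W = measure_pmf.expectation p (\<lambda>y. (W y)\<^sup>2) - (real n * a)\<^sup>2"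
      by (subst measure_pmf.variance_eq) (simp_all add: int EW)
    then show ?thesis using EW2 by (simp add: EW)
  qed
  have b_le: "b \<le> a\<^sup>2 * exp (real m / n * (exp l - 1)\<^sup>2)"
  proof -
    \<comment> \<open>With d = e^l - 1, e^(2l) - 1 = 2d + d^2. So each round contributes at most a
      factor 1 + d^2/n to the ratio of \<open>b\<close> to \<open>a\<^sup>2\<close>.\<close>
    have "1 + (exp (2 * l) - 1) / n = 1 + 2 * q + (exp l - 1)\<^sup>2 / n"
      using n exp_add[of l l] by (simp add: q_def power2_eq_square field_simps)
    also have "\<dots> \<le> (1 + q)\<^sup>2 * (1 + (exp l - 1)\<^sup>2 / n)"
    proof -
      have "1 * ((exp l - 1)\<^sup>2 / n) \<le> (1 + q)\<^sup>2 * ((exp l - 1)\<^sup>2 / n)"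
        using q0 by (intro mult_right_mono) auto
      moreover have "1 + 2 * q \<le> (1 + q)\<^sup>2" by (simp add: power2_sum)
      ultimately show ?thesis unfolding distrib_left by linarith
    qed
    also have "\<dots> \<le> (1 + q)\<^sup>2 * exp ((exp l - 1)\<^sup>2 / n)"
      by (intro mult_left_mono exp_ge_add_one_self) auto
    finally have "b \<le> ((1 + q)\<^sup>2 * exp ((exp l - 1)\<^sup>2 / n)) ^ m"
      unfolding b_def using l by (intro power_mono) auto
    also have "\<dots> = a\<^sup>2 * exp (real m / n * (exp l - 1)\<^sup>2)"
      by (simp add: power_mult_distrib a_def power_mult[symmetric] mult.commute
          exp_of_nat_mult[symmetric])
    finally show ?thesis .
  qed
  \<comment> \<open>Chebyshev: falling to half the mean is a deviation of at least half the mean,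
    whence the factor 4.\<close>
  have "measure_pmf.prob p {y. W y \<le> real n * a / 2} \<le>
      measure_pmf.prob p {y \<in> space (measure_pmf p). (W y - real n * a)\<^sup>2 \<ge> (real n * a / 2)\<^sup>2}"
  proof (intro measure_pmf.finite_measure_mono subsetI)
    fix y assume "y \<in> {y. W y \<le> real n * a / 2}"
    then have "(real n * a / 2)\<^sup>2 \<le> (real n * a - W y)\<^sup>2"
      using a0 by (intro power_mono) (auto simp: mult.commute)
    then show "y \<in> {y \<in> space (measure_pmf p). (W y - real n * a)\<^sup>2 \<ge> (real n * a / 2)\<^sup>2}"
      by (simp add: power2_commute)
  qed auto
  also have "\<dots> \<le> measure_pmf.expectation p (\<lambda>y. (W y - real n * a)\<^sup>2) / (real n * a / 2)\<^sup>2"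
    using n a0 by (intro integral_Markov_inequality_measure[where A = "{}"]) (auto simp: int)
  also have "\<dots> \<le> n * (a\<^sup>2 * exp (real m / n * (exp l - 1)\<^sup>2)) / (real n * a / 2)\<^sup>2"
    using var b_le n by (intro divide_right_mono) (auto elim!: order_trans)
  also have "\<dots> = 4 / real n * exp (real m / real n * (exp l - 1)\<^sup>2)"
    using n a0 by (simp add: power2_eq_square field_simps)
  finally show ?thesis by (simp add: p_def W_def a_def)
qed

text \<open>Take logarithms in W \<le> n exp(l max y) and use ln(1 + q) \<ge> q - q^2, valid as
  \<open>n2\<close> gives q \<le> 1. The linear term of e^l - 1 cancels against l times the average
  load, so the gain is the quadratic term; ln 2 pays for the halved mean.\<close>

lemma mult_gap_ge_of_exp_sum:
  fixes l :: real
  assumes n: "n > 0" and l: "l \<ge> 0" "l \<le> 1" and n2: "exp l - 1 \<le> real n"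
  defines "q \<equiv> (exp l - 1) / real n"
  assumes W: "(\<Sum>i<n. exp (l * real (y i))) > real n * (1 + q) ^ m / 2"
  shows "l * gap n m y \<ge> real m / n * (l\<^sup>2 / 2 - (exp l - 1)\<^sup>2 / n) - ln 2"
proof -
  define Y where "Y = real (Max (y ` {..<n}))"
  have q: "0 \<le> q" "q \<le> 1" using l n n2 by (auto simp: q_def)
  have "real n * (1 + q) ^ m / 2 < (\<Sum>i<n. exp (l * real (y i)))" by (rule W)
  also have "\<dots> \<le> (\<Sum>i<n. exp (l * Y))"
    using l by (intro sum_mono) (auto simp: Y_def intro!: mult_left_mono)
  finally have "(1 + q) ^ m / 2 < exp (l * Y)" using n by (simp add: field_simps)
  then have "ln ((1 + q) ^ m / 2) < l * Y"
    using q ln_less_cancel_iff[of "(1 + q) ^ m / 2" "exp (l * Y)"] by simp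
  then have "real m * ln (1 + q) - ln 2 < l * Y"
    using q by (simp add: ln_div ln_realpow)
  moreover have "real m * (q - q\<^sup>2) \<le> real m * ln (1 + q)"
    using q by (intro mult_left_mono ln_one_plus_pos_lower_bound) auto
  moreover have "real m * (q - q\<^sup>2) - l * (real m / n) =
      real m / n * (exp l - 1 - l - (exp l - 1)\<^sup>2 / n)"
    using n by (simp add: q_def field_simps power2_eq_square)
  moreover have "real m / n * (exp l - 1 - l - (exp l - 1)\<^sup>2 / n) \<ge>
      real m / n * (l\<^sup>2 / 2 - (exp l - 1)\<^sup>2 / n)"
    using exp_lower_Taylor_quadratic[OF l(1)] by (intro mult_left_mono) auto
  ultimately show ?thesis by (simp add: gap_def Y_def algebra_simps)
qed

section \<open>Elementary estimates and choice of parameters\<close>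

lemma exp_minus_one_le_double:
  fixes l :: real
  assumes "0 \<le> l" "l \<le> 1"
  shows "exp l - 1 \<le> 2 * l"
proof -
  have "l\<^sup>2 \<le> l" using assms by (simp add: power2_eq_square mult_left_le)
  then show ?thesis using exp_bound[OF assms] by linarith
qed

text \<open>The rate 2l may exceed 1, where \<open>exp_bound\<close> does not apply, so the bound
  for e^l is squared instead; the higher coefficients 3 + 2 + 1 give 6.\<close>

lemma exp_double_Taylor_le:
  fixes l :: real
  assumes "0 \<le> l" "l \<le> 1"
  shows "exp (2 * l) - 1 - 2 * l \<le> 6 * l\<^sup>2"
proof -
  have "exp (2 * l) = exp l * exp l" by (simp add: exp_add[symmetric])
  also have "\<dots> \<le> (1 + l + l\<^sup>2) * (1 + l + l\<^sup>2)"
    using exp_bound[OF assms] assms by (intro mult_mono) auto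
  also have "\<dots> = 1 + 2 * l + 3 * l\<^sup>2 + 2 * (l * l\<^sup>2) + l\<^sup>2 * l\<^sup>2"
    by (simp add: power2_eq_square algebra_simps)
  finally have "exp (2 * l) \<le> 1 + 2 * l + 3 * l\<^sup>2 + 2 * (l * l\<^sup>2) + l\<^sup>2 * l\<^sup>2" .
  moreover have "l * l\<^sup>2 \<le> l\<^sup>2" "l\<^sup>2 * l\<^sup>2 \<le> l\<^sup>2"
    using assms power_le_one[OF assms, of 2] mult_right_mono[of "l\<^sup>2" 1 "l\<^sup>2"]
      mult_right_mono[of l 1 "l\<^sup>2"] by simp_all
  ultimately show ?thesis by linarith
qed

theorem lemma3p13:
  fixes f :: "nat \<Rightarrow> real"
  assumes "\<And>n. n \<ge> 1 \<Longrightarrow> f n \<ge> ln (real n)"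
  shows "\<forall>\<^sub>F n in sequentially.
    let m = nat \<lfloor>1 / 24 * (real n * (f n)\<^sup>2 / ln (real n))\<rfloor> in
      measure_pmf.prob (rel_threshold n f m) {x. gap n m x \<ge> f n / 50}
        \<ge> 1 - real n powr (- 1 / 4)"
proof -
  \<comment> \<open>Three largeness conditions: n \<ge> 3 gives ln n > 0 and e^l - 1 \<le> n; the
    slack between 1/48 and 1/50 absorbs all lower-order losses; the two failure probabilities fit
    into n^(-1/4).\<close>
  have "\<forall>\<^sub>F n in sequentially. n \<ge> (3::nat)" by (rule eventually_ge_at_top)
  moreover have "\<forall>\<^sub>F n in sequentially. ln (real n) / 48 - 1 / (2 * real n) - ln (real n) / (6 * real n)
      - ln 2 \<ge> ln (real n) / 50"
    by real_asymp
  moreover have "\<forall>\<^sub>F n in sequentially.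
      real n powr (- 3 / 4) + 4 * real n powr (- 5 / 6) \<le> real n powr (- 1 / 4)"
    by real_asymp
  ultimately show ?thesis
  proof eventually_elim
    case (elim n)
    define L where "L = ln (real n)"
    \<comment> \<open>The hypothesis on \<open>f\<close> says precisely that this rate is at most 1.
      It makes l f(n) = L, and m l^2/n equals L/24 up to rounding.\<close>
    define l where "l = L / f n"
    define m where "m = nat \<lfloor>1 / 24 * (real n * (f n)\<^sup>2 / L)\<rfloor>"
    have n: "n > 0" and L: "L > 0" and nL: "real n = exp L" using elim by (auto simp: L_def)
    have f: "f n \<ge> L" using assms[of n] n by (simp add: L_def)
    then have f0: "f n > 0" using L by linarith
    have l: "0 < l" "l \<le> 1" using f f0 L by (auto simp: l_def)
    have lf: "l * f n = L" using f0 by (simp add: l_def)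
    have quot: "1 / 24 * (real n * (f n)\<^sup>2 / L) / n * l\<^sup>2 = L / 24"
      using f0 L n by (simp add: l_def power2_eq_square field_simps)
    have m: "real m \<le> 1 / 24 * (real n * (f n)\<^sup>2 / L)" "1 / 24 * (real n * (f n)\<^sup>2 / L) - 1 \<le> real m"
    proof -
      have "0 \<le> 1 / 24 * (real n * (f n)\<^sup>2 / L)" using L by simp
      then show "real m \<le> 1 / 24 * (real n * (f n)\<^sup>2 / L)"
        "1 / 24 * (real n * (f n)\<^sup>2 / L) - 1 \<le> real m"
        unfolding m_def by linarith+
    qed
    have mu_le: "real m / n * l\<^sup>2 \<le> L / 24"
      unfolding quot[symmetric] using m(1) by (intro mult_right_mono divide_right_mono) auto
    have mu_ge: "real m / n * l\<^sup>2 \<ge> L / 24 - 1 / n"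
    proof -
      \<comment> \<open>The floor in \<open>m\<close> costs less than one ball, hence at most l^2/n
        \<le> 1/n.\<close>
      have "L / 24 - 1 / n \<le> L / 24 - 1 / n * l\<^sup>2"
        using l n by (auto simp: divide_right_mono power_le_one)
      also have "\<dots> = (1 / 24 * (real n * (f n)\<^sup>2 / L) - 1) / n * l\<^sup>2"
        by (simp only: diff_divide_distrib left_diff_distrib quot)
      also have "\<dots> \<le> real m / n * l\<^sup>2"
        using m(2) by (intro mult_right_mono divide_right_mono) auto
      finally show ?thesis .
    qed
    have d: "exp l - 1 \<le> 2 * l" using l by (intro exp_minus_one_le_double) auto
    have d2: "(exp l - 1)\<^sup>2 \<le> 4 * l\<^sup>2"
    proof -
      have "(exp l - 1)\<^sup>2 \<le> (2 * l)\<^sup>2" using d l by (intro power_mono) auto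
      then show ?thesis by (simp add: power_mult_distrib)
    qed
    have mu_d2: "real m / n * (exp l - 1)\<^sup>2 \<le> L / 6"
    proof -
      have "real m / n * (exp l - 1)\<^sup>2 \<le> real m / n * (4 * l\<^sup>2)"
        using d2 by (intro mult_left_mono) auto
      then show ?thesis using mu_le by linarith
    qed

    define p where "p = one_choice n m (\<lambda>_. 0)"
    define A where "A = {x. gap n m x \<ge> f n / 50}"
    have "1 - measure_pmf.prob p A = measure_pmf.prob p (- A)"
      by (simp add: measure_pmf.prob_compl[of A p, simplified, symmetric] Compl_eq_Diff_UNIV)
    also have "\<dots> \<le> measure_pmf.prob p
        {y. (\<Sum>i<n. exp (l * real (y i))) \<le> real n * (1 + (exp l - 1) / n) ^ m / 2}"
    proof (intro measure_pmf.finite_measure_mono subsetI, rule ccontr)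
      fix y assume y: "y \<in> - A"
        "y \<notin> {y. (\<Sum>i<n. exp (l * real (y i))) \<le> real n * (1 + (exp l - 1) / n) ^ m / 2}"
      have "real m / n * (l\<^sup>2 / 2 - (exp l - 1)\<^sup>2 / n) - ln 2 \<le> l * gap n m y"
        using y d l n elim(1) by (intro mult_gap_ge_of_exp_sum) auto
      moreover have "real m / n * (l\<^sup>2 / 2 - (exp l - 1)\<^sup>2 / n) =
          real m / n * l\<^sup>2 / 2 - real m / n * (exp l - 1)\<^sup>2 / n"
        by (simp add: algebra_simps)
      moreover have "real m / n * (exp l - 1)\<^sup>2 / n \<le> L / 6 / n"
        using mu_d2 by (intro divide_right_mono) auto
      moreover have "L / 48 - 1 / (2 * real n) \<le> real m / n * l\<^sup>2 / 2"
        using divide_right_mono[OF mu_ge, of 2] by (simp add: diff_divide_distrib mult.commute)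
      ultimately have "l * gap n m y \<ge> L / 48 - 1 / (2 * real n) - L / 6 / n - ln 2"
        by argo
      moreover have "L / 48 - 1 / (2 * real n) - L / 6 / n - ln 2 \<ge> l * (f n / 50)"
        using elim(2) lf by (simp add: L_def)
      ultimately have "l * (f n / 50) \<le> l * gap n m y" by linarith
      then show False using y(1) l by (simp add: A_def)
    qed simp
    also have "\<dots> \<le> 4 / real n * exp (real m / real n * (exp l - 1)\<^sup>2)"
      unfolding p_def using n l by (intro prob_one_choice_exp_sum_small) auto
    also have "\<dots> \<le> 4 / real n * exp (L / 6)"
      using mu_d2 by (intro mult_left_mono) auto
    also have "\<dots> = 4 * real n powr (- 5 / 6)"
    proof -
      \<comment> \<open>Since n = e^L, the exponent is L/6 - L = -5L/6.\<close>
      have "exp (L / 6) / real n = exp (L / 6 - L)" by (simp only: nL exp_diff)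
      also have "\<dots> = real n powr (- 5 / 6)" using n by (simp add: powr_def L_def)
      finally show ?thesis by simp
    qed
    finally have p: "measure_pmf.prob p A \<ge> 1 - 4 * real n powr (- 5 / 6)" by linarith

    \<comment> \<open>Rate 2l is used here: at rate l the factor exp(-l f(n)) = 1/n would merely
      cancel the union bound over n bins. The total exponent is at most L + 6L/24 - 2L =
      -3L/4.\<close>
    have "real n * exp ((exp (2 * l) - 1 - 2 * l) * (real m / real n) - 2 * l * f n)
        \<le> real n * exp (L / 4 - 2 * L)"
    proof -
      have "(exp (2 * l) - 1 - 2 * l) * (real m / real n) \<le> 6 * l\<^sup>2 * (real m / n)"
        using l by (intro mult_right_mono exp_double_Taylor_le) auto
      also have "\<dots> \<le> L / 4" using mu_le by (simp add: mult.commute)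
      finally have "(exp (2 * l) - 1 - 2 * l) * (real m / real n) - 2 * l * f n \<le> L / 4 - 2 * L"
        using lf by (simp only: mult.assoc diff_right_mono)
      then show ?thesis by (intro mult_left_mono) (simp_all only: exp_le_cancel_iff of_nat_0_le_iff)
    qed
    also have "\<dots> = exp (L + (L / 4 - 2 * L))" by (simp only: exp_add nL)
    also have "\<dots> = real n powr (- 3 / 4)" using n by (simp add: powr_def L_def)
    finally have "measure_pmf.prob (rel_threshold n f m) A \<ge>
        measure_pmf.prob p A - real n powr (- 3 / 4)"
      using prob_rel_threshold_ge_one_choice[OF n, of "2 * l" m A f] l unfolding p_def by linarith
    with p elim(3) have "measure_pmf.prob (rel_threshold n f m) A \<ge> 1 - real n powr (- 1 / 4)"
      by linarith
    then show ?case by (simp add: m_def L_def A_def Let_def)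
  qed
qed

end
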